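(* Let $b\geq 2$. If there exists a $k$-oasis base $b$, then \[k\leq \frac{b^3}{2}+\frac{b^2}{2}-b.\]
   Context: For integers $c\geq 0$ and $b\geq 2$, the augmented generalized happy function $S_{[c,b]}:\mathbb{Z}^+\to\mathbb{Z}^+$ is defined by $S_{[c,b]}\left(\sum_{i=0}^n a_i b^i\right)=c+\sum_{i=0}^n a_i^2$, where $0\le a_i\le b-1$, $a_n\neq 0$ (the base $b$ expansion). A positive integer $a$ is a fixed point of $S_{[c,b]}$ if $S_{[c,b]}(a)=a$. For $b\geq 2$ and $k\in\mathbb{Z}^+$, a $k$-oasis base $b$ is a set of $k$ consecutive non-negative integers $c$ such that for each of them $S_{[c,b]}$ has at least one fixed point. *)

theory Defs
  imports Complex_Main
begin

text \<open>Digit lists have the least significant digit first; numbers of type \<^typ>\<open>nat\<close>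
  in the role of a positive integer carry an explicit positivity condition.\<close>

definition base_expansion :: "nat \<Rightarrow> nat list \<Rightarrow> nat \<Rightarrow> bool" where
  "base_expansion b ds a \<longleftrightarrow>
     ds \<noteq> [] \<and> (\<forall>d\<in>set ds. d \<le> b - 1) \<and> last ds \<noteq> 0 \<and>
     a = (\<Sum>i<length ds. ds ! i * b ^ i)"

lemma base_expansion_Cons:
  "base_expansion b (d # ds) a \<longleftrightarrow>
     d \<le> b - 1 \<and> (if ds = [] then d \<noteq> 0 \<and> a = d
       else \<exists>a'. base_expansion b ds a' \<and> a = d + b * a')"
  by (auto simp: base_expansion_def sum.lessThan_Suc_shift sum_distrib_left algebra_simps
      simp del: sum.lessThan_Suc)

lemma base_expansion_pos:
  assumes "b \<ge> 2" and "base_expansion b ds a"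
  shows "a > 0"
  using assms(2)
proof (induction ds arbitrary: a)
  case (Cons d ds)
  then show ?case
    using assms(1) by (fastforce simp: base_expansion_Cons split: if_splits)
qed (simp add: base_expansion_def)

lemma base_expansion_exists:
  assumes "b \<ge> 2" and "a > 0"
  shows "\<exists>ds. base_expansion b ds a"
  using assms(2)
proof (induction a rule: less_induct)
  case (less a)
  show ?case
  proof (cases "a < b")
    case True
    then have "base_expansion b [a] a"
      using less.prems by (auto simp: base_expansion_Cons)
    then show ?thesis ..
  next
    case False
    have "a div b < a" "a div b > 0"
      using False assms(1) less.prems by (auto simp: div_greater_zero_iff)
    then obtain ds where ds: "base_expansion b ds (a div b)"
      using less.IH by blast
    have "a mod b < b"
      using assms(1) by simp
    then have "a mod b \<le> b - 1"
      by linarith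
    moreover have "ds \<noteq> []"
      using ds by (simp add: base_expansion_def)
    moreover have "a = a mod b + b * (a div b)"
      by simp
    ultimately have "base_expansion b (a mod b # ds) a"
      unfolding base_expansion_Cons using ds by auto
    then show ?thesis ..
  qed
qed

lemma base_expansion_unique:
  assumes b: "b \<ge> 2" and "base_expansion b ds a" "base_expansion b es a"
  shows "ds = es"
  using assms(2,3)
proof (induction ds arbitrary: es a)
  case Nil
  then show ?case by (simp add: base_expansion_def)
next
  case (Cons d ds)
  from Cons.prems(2) obtain e es' where es: "es = e # es'"
    by (cases es) (auto simp: base_expansion_def)
  define x where "x = a div b"
  have d: "d = a mod b \<and> (if ds = [] then x = 0 else base_expansion b ds x)"
    using Cons.prems(1) b by (auto simp: base_expansion_Cons x_def split: if_splits)
  have e: "e = a mod b \<and> (if es' = [] then x = 0 else base_expansion b es' x)"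
    using Cons.prems(2) b unfolding es
    by (auto simp: base_expansion_Cons x_def split: if_splits)
  have "ds = es'"
  proof (cases "x = 0")
    case True
    then show ?thesis
      using d e base_expansion_pos[OF b] by (metis less_numeral_extra(3))
  next
    case False
    then show ?thesis
      using d e Cons.IH by (metis (full_types))
  qed
  then show ?case
    using d e es by simp
qed

definition digits :: "nat \<Rightarrow> nat \<Rightarrow> nat list" where
  "digits b a = (THE ds. base_expansion b ds a)"

lemma digits_eqI: "b \<ge> 2 \<Longrightarrow> base_expansion b ds a \<Longrightarrow> digits b a = ds"
  unfolding digits_def by (blast intro: the_equality base_expansion_unique)

text \<open>Meaningful only for \<open>b \<ge> 2\<close> and \<open>a > 0\<close>.\<close>

definition aug_happy :: "nat \<Rightarrow> nat \<Rightarrow> nat \<Rightarrow> nat" where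
  "aug_happy c b a = c + (\<Sum>i<length (digits b a). (digits b a ! i)\<^sup>2)"

lemma aug_happy_eqI:
  assumes "b \<ge> 2" and "base_expansion b ds a"
  shows "aug_happy c b a = c + (\<Sum>i<length ds. (ds ! i)\<^sup>2)"
  using digits_eqI[OF assms] by (simp add: aug_happy_def)

definition is_fixed_point :: "nat \<Rightarrow> nat \<Rightarrow> nat \<Rightarrow> bool" where
  "is_fixed_point c b a \<longleftrightarrow> a > 0 \<and> aug_happy c b a = a"

definition is_oasis :: "nat \<Rightarrow> nat \<Rightarrow> nat set \<Rightarrow> bool" where
  "is_oasis k b C \<longleftrightarrow>
     b \<ge> 2 \<and> k > 0 \<and> (\<exists>m. C = {m..<m + k}) \<and> (\<forall>c\<in>C. \<exists>a. is_fixed_point c b a)"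

end

theory Submission
  imports Defs
begin

text \<open>An integer \<open>c\<close> admits a fixed point iff \<open>c = a - S(a)\<close> for some \<open>a > 0\<close>, where
  \<open>S(a)\<close> is the sum of the squared digits. Write \<open>a = x + b y + b\<^sup>2 z + b\<^sup>3 u\<close> with digits
  \<open>x, y, z\<close>; then \<open>c = x (1 - x) + y (b - y) + z (b\<^sup>2 - z) + h(u)\<close> with \<open>h(u) = b\<^sup>3 u - S(u)\<close>.
  Since \<open>h\<close> grows by at least \<open>b\<^sup>3 - 2 b + 3\<close> at each step, the ranges of \<open>c\<close> for different
  \<open>u\<close> are separated by gaps, so an oasis lies in the range of a single \<open>u\<close>. There,
  \<open>x (1 - x)\<close> agrees at \<open>0\<close> and \<open>1\<close>, and \<open>y (b - y)\<close> agrees at \<open>y\<close> and \<open>b - y\<close>, which leaves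
  at most \<open>(b - 1) (b/2 + 1) b\<close> values.\<close>

section \<open>Digit-square sums by recursion\<close>

text \<open>The guard \<open>b < 2\<close> secures termination. The value 0 at \<open>n = 0\<close>
  makes leading zeros harmless, so numbers with few digits need no separate case.\<close>

fun digit_sq_sum :: "nat \<Rightarrow> nat \<Rightarrow> nat" where
  "digit_sq_sum b n =
     (if b < 2 \<or> n = 0 then 0 else (n mod b)\<^sup>2 + digit_sq_sum b (n div b))"

declare digit_sq_sum.simps [simp del]

lemma digit_sq_sum_0 [simp]: "digit_sq_sum b 0 = 0"
  by (simp add: digit_sq_sum.simps)

lemma digit_sq_sum_rec:
  "b \<ge> 2 \<Longrightarrow> digit_sq_sum b n = (n mod b)\<^sup>2 + digit_sq_sum b (n div b)"
  by (subst digit_sq_sum.simps) auto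

lemma base_expansion_digit_sq_sum:
  assumes "b \<ge> 2" and "base_expansion b ds a"
  shows "(\<Sum>i<length ds. (ds ! i)\<^sup>2) = digit_sq_sum b a"
  using assms(2)
proof (induction ds arbitrary: a)
  case Nil
  then show ?case by (simp add: base_expansion_def)
next
  case (Cons d ds)
  have d: "d < b"
    using Cons.prems assms(1) by (auto simp: base_expansion_Cons)
  show ?case
  proof (cases "ds = []")
    case True
    then show ?thesis
      using Cons.prems d digit_sq_sum_rec[OF assms(1), of a]
      by (simp add: base_expansion_Cons)
  next
    case False
    then obtain a' where a': "base_expansion b ds a'" "a = d + b * a'"
      using Cons.prems by (auto simp: base_expansion_Cons)
    then show ?thesis
      using Cons.IH[OF a'(1)] d digit_sq_sum_rec[OF assms(1), of a]
      by (simp add: sum.lessThan_Suc_shift del: sum.lessThan_Suc)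
  qed
qed

lemma is_fixed_point_iff:
  assumes "b \<ge> 2"
  shows "is_fixed_point c b a \<longleftrightarrow> a > 0 \<and> c + digit_sq_sum b a = a"
proof (cases "a > 0")
  case True
  then obtain ds where "base_expansion b ds a"
    using base_expansion_exists assms by blast
  then show ?thesis
    using aug_happy_eqI base_expansion_digit_sq_sum assms
    by (simp add: is_fixed_point_def)
qed (simp add: is_fixed_point_def)

text \<open>Without a carry, a last digit d \<le> b - 2 becomes d + 1, which adds 2 d + 1 \<le> 2 b
  - 3. With a carry, the last digit drops to 0 and the bound for the quotient applies.\<close>

lemma digit_sq_sum_Suc_le:
  assumes "b \<ge> 2"
  shows "digit_sq_sum b (Suc n) + 3 \<le> digit_sq_sum b n + 2 * b"
proof (induction n rule: less_induct)
  case (less n)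
  note rec = digit_sq_sum_rec[OF assms, of "Suc n"] digit_sq_sum_rec[OF assms, of n]
  show ?case
  proof (cases "Suc (n mod b) = b")
    case True
    then have "Suc n mod b = 0" "Suc n div b = Suc (n div b)"
      by (auto simp: mod_Suc div_Suc)
    moreover have "n div b < n"
      using True assms by (intro div_less_dividend) (auto intro: gr0I)
    ultimately show ?thesis
      using less.IH[of "n div b"] rec by simp
  next
    case False
    then have "Suc n mod b = Suc (n mod b)" "Suc n div b = n div b"
      by (auto simp: mod_Suc div_Suc)
    moreover have "n mod b < b"
      using assms by simp
    then have "n mod b + 2 \<le> b"
      using False by linarith
    ultimately show ?thesis
      using rec by (simp add: power2_eq_square)
  qed
qed

section \<open>Separating the three lowest digits from the rest\<close>

definition block_offset :: "nat \<Rightarrow> nat \<Rightarrow> int" where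
  "block_offset b u = int b ^ 3 * int u - int (digit_sq_sum b u)"

lemma block_offset_diff_ge:
  assumes "b \<ge> 2" and "u < v"
  shows "block_offset b v - block_offset b u \<ge> int b ^ 3 - 2 * int b + 3"
proof -
  have step: "block_offset b (Suc w) - block_offset b w \<ge> int b ^ 3 - 2 * int b + 3" for w
    using digit_sq_sum_Suc_le[OF assms(1), of w]
    by (simp add: block_offset_def algebra_simps)
  \<comment> \<open>Nonnegative increments keep the one-step bound valid for every later
    \<open>v\<close>.\<close>
  have pos: "int b ^ 3 - 2 * int b + 3 \<ge> 0"
  proof -
    have "int b * 2 \<le> int b * int b ^ 2"
      using assms(1) power_mono[of 2 "int b" 2] by (intro mult_left_mono) auto
    then show ?thesis
      by (simp add: power3_eq_cube power2_eq_square)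
  qed
  from assms(2) show ?thesis
  proof (induction v)
    case (Suc v)
    then show ?case
      using step[of v] pos by (cases "u = v") auto
  qed simp
qed

definition block_value :: "nat \<Rightarrow> nat \<times> nat \<times> nat \<Rightarrow> int" where
  "block_value b = (\<lambda>(x, y, z).
     int x * (1 - int x) + int y * (int b - int y) + int z * (int b ^ 2 - int z))"

lemma fixed_point_block:
  assumes "b \<ge> 2" and "is_fixed_point c b a"
  obtains x y z u where "x < b" "y < b" "z < b"
    "int c = block_offset b u + block_value b (x, y, z)"
proof -
  define y z u where "y = a div b" and "z = y div b" and "u = z div b"
  have c: "c + digit_sq_sum b a = a"
    using assms is_fixed_point_iff by blast
  have "digit_sq_sum b a = (a mod b)\<^sup>2 + (y mod b)\<^sup>2 + (z mod b)\<^sup>2 + digit_sq_sum b u"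
    using digit_sq_sum_rec[OF assms(1), of a] digit_sq_sum_rec[OF assms(1), of y]
      digit_sq_sum_rec[OF assms(1), of z]
    unfolding y_def z_def u_def by linarith
  then have S: "int (digit_sq_sum b a) = int (a mod b)^2 + int (y mod b)^2
      + int (z mod b)^2 + int (digit_sq_sum b u)"
    by simp
  have "a = a mod b + b * (y mod b + b * (z mod b + b * u))"
    by (simp add: y_def z_def u_def)
  then have "int a = int (a mod b + b * (y mod b + b * (z mod b + b * u)))"
    by simp
  then have "int a = int (a mod b) + int b * (int (y mod b) + int b * (int (z mod b) + int b * int u))"
    by (simp only: of_nat_add of_nat_mult)
  moreover have "int c = int a - int (digit_sq_sum b a)"
    using c by linarith
  ultimately have "int c = block_offset b u + block_value b (a mod b, y mod b, z mod b)"
    unfolding block_offset_def block_value_def prod.case S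
    by (simp only: power2_eq_square power3_eq_cube) (simp only: algebra_simps)
  then show thesis
    using assms(1) by (intro that[of "a mod b" "y mod b" "z mod b" u]) auto
qed

section \<open>Range of a block and gaps between blocks\<close>

lemma block_value_ge:
  assumes "x < b" "y < b" "z < b"
  shows "block_value b (x, y, z) \<ge> - ((int b - 1) * (int b - 2))"
proof -
  \<comment> \<open>The product equals (b - 1) (b - 2) + x (1 - x). For b = 1 the second factor is
    negative, but the first vanishes.\<close>
  have "(int b - 1 - int x) * (int b - 2 + int x) \<ge> 0"
  proof (cases "b = 1")
    case False
    then show ?thesis using assms by (intro mult_nonneg_nonneg) auto
  qed (use assms in auto)
  then have "int x * (1 - int x) \<ge> - ((int b - 1) * (int b - 2))"
    by (simp add: algebra_simps)
  moreover have "int y * (int b - int y) \<ge> 0"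
    using assms by simp
  moreover have "int z * (int b ^ 2 - int z) \<ge> 0"
    using assms self_le_power[of "int b" 2] by (intro mult_nonneg_nonneg) auto
  ultimately show ?thesis
    by (simp add: block_value_def)
qed

text \<open>The factor 4 keeps the bound y (b - y) \<le> b^2 / 4 within the integers.\<close>

lemma block_value_le:
  assumes "x < b" "y < b" "z < b"
  shows "4 * block_value b (x, y, z) \<le> 4 * ((int b - 1) * (int b ^ 2 - int b + 1)) + int b ^ 2"
proof -
  have "int x * (1 - int x) \<le> 0"
    by (cases x) (auto simp: mult_nonneg_nonpos)
  moreover have "4 * (int y * (int b - int y)) \<le> int b ^ 2"
    using zero_le_power2[of "int b - 2 * int y"]
    by (simp add: power2_eq_square algebra_simps)
  moreover have "int z * (int b ^ 2 - int z) \<le> (int b - 1) * (int b ^ 2 - int b + 1)"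
  proof -
    have "0 \<le> (int b - 1)\<^sup>2" by simp
    then have "int b ^ 2 \<ge> 2 * int b - 1"
      by (simp add: power2_eq_square algebra_simps)
    \<comment> \<open>The two subtracted-from terms sum to b^2, so the product is (b - 1) (b^2 - b +
      1) - z (b^2 - z).\<close>
    then have "(int b - 1 - int z) * (int b ^ 2 - (int b - 1) - int z) \<ge> 0"
      using assms by (intro mult_nonneg_nonneg) auto
    then show ?thesis
      by (simp add: algebra_simps)
  qed
  \<comment> \<open>Variables stand for the nonlinear terms, leaving a goal of linear
    arithmetic.\<close>
  moreover have "4 * (p + q + r) \<le> 4 * R + B" if "p \<le> 0" "4 * q \<le> B" "r \<le> R" for p q r R B :: int
    using that by presburger
  ultimately show ?thesis
    unfolding block_value_def prod.case by blast
qed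

definition block :: "nat \<Rightarrow> nat \<Rightarrow> int set" where
  "block b u = (\<lambda>t. block_offset b u + block_value b t) ` ({..<b} \<times> {..<b} \<times> {..<b})"

lemma block_separated:
  assumes "b \<ge> 2" and "u < v" and "s \<in> block b u" and "t \<in> block b v"
  shows "s + 1 < t"
proof -
  have s: "4 * (s - block_offset b u) \<le> 4 * ((int b - 1) * (int b ^ 2 - int b + 1)) + int b ^ 2"
    using assms(3) block_value_le by (fastforce simp: block_def)
  have t: "t - block_offset b v \<ge> - ((int b - 1) * (int b - 2))"
    using assms(4) block_value_ge by (fastforce simp: block_def)
  have "4 * ((int b - 1) * (int b ^ 2 - int b + 1)) + int b ^ 2 + 4 * ((int b - 1) * (int b - 2)) + 4
      < 4 * (int b ^ 3 - 2 * int b + 3)"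
  proof -
    \<comment> \<open>The right side minus the left side of the goal is 3 b^2 - 4 b + 4, which is
      this product plus 8.\<close>
    have "(int b - 2) * (3 * int b + 2) \<ge> 0"
      using assms(1) by (intro mult_nonneg_nonneg) auto
    then show ?thesis
      by (simp add: power2_eq_square power3_eq_cube algebra_simps)
  qed
  moreover have "s + 1 < t"
    if "A + 4 * L + 4 < 4 * D" "4 * (s - p) \<le> A" "t - q \<ge> - L" "q - p \<ge> D" for p q A L D :: int
    using that by presburger
  ultimately show ?thesis
    using s t block_offset_diff_ge[OF assms(1,2)] by blast
qed

section \<open>Counting a block\<close>

lemma block_subset_image:
  assumes "b \<ge> 2"
  shows "block b u \<subseteq>
    (\<lambda>t. block_offset b u + block_value b t) ` ({1..<b} \<times> {..b div 2} \<times> {..<b})"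
proof
  fix s assume "s \<in> block b u"
  then obtain x y z where xyz: "x < b" "y < b" "z < b"
    and s: "s = block_offset b u + block_value b (x, y, z)"
    by (auto simp: block_def)
  \<comment> \<open>Reflecting only y > \<open>b div 2\<close> gives b - y \<le>
    \<open>b div 2\<close> and leaves y = 0 alone. The digit 1 is available since b \<ge> 2.\<close>
  define x' y' where "x' = (if x = 0 then 1 else x)" and "y' = (if y \<le> b div 2 then y else b - y)"
  have "int x' * (1 - int x') = int x * (1 - int x)"
    by (simp add: x'_def)
  moreover have "int y' * (int b - int y') = int y * (int b - int y)"
    using xyz by (simp add: y'_def of_nat_diff)
  ultimately have "s = block_offset b u + block_value b (x', y', z)"
    by (simp add: s block_value_def)
  moreover have "x' \<in> {1..<b}" "y' \<le> b div 2"
    using xyz assms by (auto simp: x'_def y'_def)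
  ultimately show "s \<in> (\<lambda>t. block_offset b u + block_value b t) ` ({1..<b} \<times> {..b div 2} \<times> {..<b})"
    using xyz by blast
qed

lemma card_block_le:
  assumes "b \<ge> 2"
  shows "finite (block b u)" "card (block b u) \<le> (b - 1) * (b div 2 + 1) * b"
proof -
  let ?T = "{1..<b} \<times> {..b div 2} \<times> {..<b}"
  show "finite (block b u)"
    by (simp add: block_def)
  have "card (block b u) \<le> card ((\<lambda>t. block_offset b u + block_value b t) ` ?T)"
    by (intro card_mono block_subset_image assms) auto
  also have "\<dots> \<le> card ?T"
    by (intro card_image_le) auto
  finally show "card (block b u) \<le> (b - 1) * (b div 2 + 1) * b"
    by (simp add: card_cartesian_product algebra_simps)
qed

text \<open>Elements of different blocks differ by more than 1, so passing to the next integer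
  cannot change the block.\<close>

lemma consecutive_in_one_block:
  assumes "b \<ge> 2" and "\<And>j. j < k \<Longrightarrow> \<exists>u. m + int j \<in> block b u"
    and "m \<in> block b u" and "j < k"
  shows "m + int j \<in> block b u"
  using assms(4)
proof (induction j)
  case 0
  then show ?case using assms(3) by simp
next
  case (Suc j)
  then have j: "m + int j \<in> block b u" by simp
  obtain v where v: "m + int (Suc j) \<in> block b v"
    using assms(2) Suc.prems by blast
  have "\<not> u < v" "\<not> v < u"
    using block_separated[OF assms(1) _ j v] block_separated[OF assms(1) _ v j] by auto
  then show ?case
    using v by simp
qed

theorem theorem7:
  fixes b k :: nat
  assumes "b \<ge> 2"
    and "\<exists>C. is_oasis k b C"
  shows "real k \<le> real b ^ 3 / 2 + real b ^ 2 / 2 - real b"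
proof -
  obtain m where k: "k > 0" and fixed: "\<forall>c\<in>{m..<m + k}. \<exists>a. is_fixed_point c b a"
    using assms(2) by (auto simp: is_oasis_def)
  have block: "\<exists>u. int m + int j \<in> block b u" if "j < k" for j
  proof -
    obtain a where "is_fixed_point (m + j) b a"
      using fixed \<open>j < k\<close> by (metis atLeastLessThan_iff le_add1 nat_add_left_cancel_less)
    then obtain x y z u where "x < b" "y < b" "z < b"
      "int (m + j) = block_offset b u + block_value b (x, y, z)"
      by (rule fixed_point_block[OF assms(1)])
    then show ?thesis
      unfolding block_def by (intro exI[of _ u] image_eqI[of _ _ "(x, y, z)"]) auto
  qed
  then obtain u where u: "int m \<in> block b u"
    using k by force
  \<comment> \<open>The oasis is a set of \<open>k\<close> distinct integers inside one block, so
    the size of that block bounds \<open>k\<close>.\<close>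
  have "(\<lambda>j. int m + int j) ` {..<k} \<subseteq> block b u"
    using consecutive_in_one_block[OF assms(1) block u] by auto
  then have "card ((\<lambda>j. int m + int j) ` {..<k}) \<le> card (block b u)"
    by (intro card_mono card_block_le assms(1))
  then have "k \<le> (b - 1) * (b div 2 + 1) * b"
    using card_block_le(2)[OF assms(1), of u] by (simp add: card_image inj_on_def)
  then have "real k \<le> real ((b - 1) * (b div 2 + 1) * b)"
    by (simp only: of_nat_le_iff)
  also have "\<dots> = (real b - 1) * (real (b div 2) + 1) * real b"
    using assms(1) by (simp add: of_nat_diff del: of_nat_Suc) (simp add: algebra_simps)
  \<comment> \<open>Dropping the floor in \<open>b div 2\<close> loses something only for odd
    \<open>b\<close>.\<close>
  also have "\<dots> \<le> (real b - 1) * (real b / 2 + 1) * real b"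
    using assms(1) of_nat_div_le_of_nat[of b 2, where 'a = real]
    by (intro mult_right_mono mult_left_mono) auto
  also have "\<dots> = real b ^ 3 / 2 + real b ^ 2 / 2 - real b"
    by (simp add: power2_eq_square power3_eq_cube field_simps)
  finally show ?thesis .
qed

end
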